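(* Let $\Lambda:[0,\infty)\to[0,1]$ be an increasing (nondecreasing) cadlag function with $\Lambda_0=0$. Then $\Lambda$ is a solution to the elastic feedback problem with initial condition $X_{0-}$, feedback parameter $\alpha$ and elastic variable $\xi$ if and only if it is a solution to the absorbing feedback problem with feedback parameter $\alpha$ and initial condition $Y_{0-}:=X_{0-}+\xi$.
   Context: Setting. $\alpha>0$ and $\kappa>0$ are constants; $X_{0-}$ is a $[0,\infty)$-valued random variable; $B$ is a standard Brownian motion started at $0$; $\xi$ is an exponential random variable with parameter (rate) $\kappa$; $X_{0-}$, $B$, $\xi$ are independent. $\inf\emptyset=\infty$. Elastic feedback problem. An increasing deterministic cadlag function $\Lambda$ is a solution if, setting for $t\ge0$ $$Y_t=X_{0-}+B_t-\alpha\Lambda_t,\quad L_t=\Big(-\inf_{0\le s\le t}Y_s\Big)\vee 0,\quad X_t=Y_t+L_t,\quad \tau=\inf\{t\ge0: L_t\ge\xi\},$$ one has $\Lambda_t=\mathbb P(\tau\le t)$ for all $t\ge0$. Absorbing feedback problem with initial condition $Y_{0-}$. An increasing deterministic cadlag function $\Lambda^a$ is a solution if, setting $Y_t=Y_{0-}+B_t-\alpha\Lambda^a_t$ for $t\ge 0$ and $\tau^a=\inf\{t\ge0:Y_t\le0\}$, one has $\Lambda^a_t=\mathbb P(\tau^a\le t)$ for all $t\ge0$. *)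

theory Defs
  imports "HOL-Probability.Probability"
begin

text \<open>
  Time-indexed functions and processes have time type \<^typ>\<open>real\<close>; only their values at
  times \<open>t \<ge> 0\<close> are ever constrained or used.
\<close>

definition cadlag :: "(real \<Rightarrow> real) \<Rightarrow> bool" where
  "cadlag f \<longleftrightarrow>
     (\<forall>t\<ge>0. continuous (at_right t) f) \<and>
     (\<forall>t>0. \<exists>l. (f \<longlongrightarrow> l) (at_left t))"

text \<open>
  As usual for processes, the normalisation at time 0 is almost sure, whereas every path is
  continuous.
\<close>

definition standard_brownian_motion :: "'a measure \<Rightarrow> (real \<Rightarrow> 'a \<Rightarrow> real) \<Rightarrow> bool" where
  "standard_brownian_motion M B \<longleftrightarrow>
     prob_space M \<and>
     (\<forall>t\<ge>0. B t \<in> borel_measurable M) \<and>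
     (AE \<omega> in M. B 0 \<omega> = 0) \<and>
     (\<forall>\<omega>\<in>space M. continuous_on {0..} (\<lambda>t. B t \<omega>)) \<and>
     (\<forall>s t. 0 \<le> s \<longrightarrow> s < t \<longrightarrow>
        distributed M lborel (\<lambda>\<omega>. B t \<omega> - B s \<omega>) (normal_density 0 (sqrt (t - s)))) \<and>
     (\<forall>n (t :: nat \<Rightarrow> real). 0 \<le> t 0 \<longrightarrow> mono_on {..n} t \<longrightarrow>
        prob_space.indep_vars M (\<lambda>_. borel) (\<lambda>i \<omega>. B (t (Suc i)) \<omega> - B (t i) \<omega>) {..<n})"

text \<open>
  Mutual independence of two random variables and a process, stated for the generated
  \<open>\<sigma>\<close>-algebras because \<^const>\<open>prob_space.indep_vars\<close> requires all variables to have the same value type.  The process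
  is a random element of \<open>\<real>\<^bsup>[0,\<infinity>)\<^esup>\<close> with the product \<open>\<sigma>\<close>-algebra.
\<close>

definition indep_var_process_var ::
    "'a measure \<Rightarrow> ('a \<Rightarrow> real) \<Rightarrow> (real \<Rightarrow> 'a \<Rightarrow> real) \<Rightarrow> ('a \<Rightarrow> real) \<Rightarrow> bool" where
  "indep_var_process_var M U B V \<longleftrightarrow>
     prob_space.indep_sets M
       (\<lambda>i. sets ([vimage_algebra (space M) U borel,
                   vimage_algebra (space M) (\<lambda>\<omega>. \<lambda>t\<in>{0..}. B t \<omega>) (PiM {0..} (\<lambda>_. borel)),
                   vimage_algebra (space M) V borel] ! i))
       {..<3}"

definition feedback_Y ::
    "real \<Rightarrow> ('a \<Rightarrow> real) \<Rightarrow> (real \<Rightarrow> 'a \<Rightarrow> real) \<Rightarrow> (real \<Rightarrow> real) \<Rightarrow> real \<Rightarrow> 'a \<Rightarrow> real" where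
  "feedback_Y \<alpha> Z B \<Lambda> t \<omega> = Z \<omega> + B t \<omega> - \<alpha> * \<Lambda> t"

text \<open>
  The infimum is taken in \<^typ>\<open>real\<close>; it is the genuine one, since a path that is the
  difference of a continuous and a nondecreasing function is bounded below on \<open>[0,t]\<close>.
\<close>

definition elastic_L ::
    "real \<Rightarrow> ('a \<Rightarrow> real) \<Rightarrow> (real \<Rightarrow> 'a \<Rightarrow> real) \<Rightarrow> (real \<Rightarrow> real) \<Rightarrow> real \<Rightarrow> 'a \<Rightarrow> real" where
  "elastic_L \<alpha> X\<^sub>0 B \<Lambda> t \<omega> = max (- (INF s\<in>{0..t}. feedback_Y \<alpha> X\<^sub>0 B \<Lambda> s \<omega>)) 0"

text \<open>The reflected state process; it does not enter the fixed-point condition.\<close>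

definition elastic_X ::
    "real \<Rightarrow> ('a \<Rightarrow> real) \<Rightarrow> (real \<Rightarrow> 'a \<Rightarrow> real) \<Rightarrow> (real \<Rightarrow> real) \<Rightarrow> real \<Rightarrow> 'a \<Rightarrow> real" where
  "elastic_X \<alpha> X\<^sub>0 B \<Lambda> t \<omega> = feedback_Y \<alpha> X\<^sub>0 B \<Lambda> t \<omega> + elastic_L \<alpha> X\<^sub>0 B \<Lambda> t \<omega>"

text \<open>Stopping times are \<^typ>\<open>ereal\<close>-valued, so the infimum of the empty set is \<open>\<infinity>\<close>.\<close>

definition elastic_tau ::
    "real \<Rightarrow> ('a \<Rightarrow> real) \<Rightarrow> (real \<Rightarrow> 'a \<Rightarrow> real) \<Rightarrow> ('a \<Rightarrow> real) \<Rightarrow> (real \<Rightarrow> real) \<Rightarrow> 'a \<Rightarrow> ereal" where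
  "elastic_tau \<alpha> X\<^sub>0 B \<xi> \<Lambda> \<omega> = Inf {ereal t | t. 0 \<le> t \<and> elastic_L \<alpha> X\<^sub>0 B \<Lambda> t \<omega> \<ge> \<xi> \<omega>}"

definition absorbing_tau ::
    "real \<Rightarrow> ('a \<Rightarrow> real) \<Rightarrow> (real \<Rightarrow> 'a \<Rightarrow> real) \<Rightarrow> (real \<Rightarrow> real) \<Rightarrow> 'a \<Rightarrow> ereal" where
  "absorbing_tau \<alpha> Y\<^sub>0 B \<Lambda> \<omega> = Inf {ereal t | t. 0 \<le> t \<and> feedback_Y \<alpha> Y\<^sub>0 B \<Lambda> t \<omega> \<le> 0}"

definition elastic_solution ::
    "'a measure \<Rightarrow> real \<Rightarrow> ('a \<Rightarrow> real) \<Rightarrow> (real \<Rightarrow> 'a \<Rightarrow> real) \<Rightarrow> ('a \<Rightarrow> real) \<Rightarrow> (real \<Rightarrow> real) \<Rightarrow> bool" where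
  "elastic_solution M \<alpha> X\<^sub>0 B \<xi> \<Lambda> \<longleftrightarrow>
     mono_on {0..} \<Lambda> \<and> cadlag \<Lambda> \<and>
     (\<forall>t\<ge>0. \<Lambda> t = measure M {\<omega> \<in> space M. elastic_tau \<alpha> X\<^sub>0 B \<xi> \<Lambda> \<omega> \<le> ereal t})"

definition absorbing_solution ::
    "'a measure \<Rightarrow> real \<Rightarrow> ('a \<Rightarrow> real) \<Rightarrow> (real \<Rightarrow> 'a \<Rightarrow> real) \<Rightarrow> (real \<Rightarrow> real) \<Rightarrow> bool" where
  "absorbing_solution M \<alpha> Y\<^sub>0 B \<Lambda> \<longleftrightarrow>
     mono_on {0..} \<Lambda> \<and> cadlag \<Lambda> \<and>
     (\<forall>t\<ge>0. \<Lambda> t = measure M {\<omega> \<in> space M. absorbing_tau \<alpha> Y\<^sub>0 B \<Lambda> \<omega> \<le> ereal t})"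

end

theory Submission
  imports Defs
begin

text \<open>
  Let \<open>Z\<^sub>t = X\<^sub>0 + \<xi> + B\<^sub>t - \<alpha> \<Lambda>\<^sub>t\<close> be the state in the absorbing problem;
  it is the elastic \<open>Y\<^sub>t\<close> raised by \<open>\<xi>\<close>.  On \<open>{\<xi> > 0}\<close>, which is almost everything, the
  truncation at 0 in \<open>L\<^sub>t\<close> is invisible to the level \<open>\<xi>\<close>: \<open>L\<^sub>t \<ge> \<xi>\<close> says exactly that
  \<open>inf\<^bsub>s\<le>t\<^esub> Z\<^sub>s \<le> 0\<close>.  The absorbing problem asks instead that \<open>Z\<close> actually reaches
  \<open>(-\<infinity>,0]\<close> by time \<open>t\<close>.  The two could differ only if the infimum were not attained.  It is
  attained, because the feedback only pushes downwards: a nondecreasing right-continuous \<open>\<Lambda>\<close> is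
  upper semicontinuous, so the paths of \<open>Z\<close> are lower semicontinuous
  (\<open>closed_sublevel_drift\<close>) and attain their minima on compact intervals
  (\<open>compact_attains_inf_of_closed_sublevels\<close>).  Hence the two stopping times coincide on
  \<open>{\<xi> > 0}\<close> for every such \<open>\<Lambda>\<close>, and the two fixed-point conditions are the same.

  As \<^const>\<open>measure\<close> takes the value 0 on every nonmeasurable set, almost sure
  agreement of the two events yields equal probabilities only once both are known to be
  measurable.  This follows by testing the path at countably many times
  (\<open>hitting_event_measurable\<close>).
\<close>

section \<open>Lower semicontinuous paths\<close>

text \<open>
  Lower semicontinuity enters as closedness of sublevel sets.  A minimum is a common point of all the
  sets \<open>{x \<in> K. f x \<le> f y}\<close>, and these have the finite intersection property because finitely
  many values \<open>f y\<close> have a smallest one.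
\<close>

lemma compact_attains_inf_of_closed_sublevels:
  fixes f :: "'a::topological_space \<Rightarrow> 'b::linorder"
  assumes "compact K" "K \<noteq> {}" and cl: "\<And>c. closed {x \<in> K. f x \<le> c}"
  shows "\<exists>x\<in>K. \<forall>y\<in>K. f x \<le> f y"
proof -
  have "K \<inter> (\<Inter>y\<in>K. {x \<in> K. f x \<le> f y}) \<noteq> {}"
  proof (rule compact_imp_fip_image[OF \<open>compact K\<close>])
    fix I assume I: "finite I" "I \<subseteq> K"
    show "K \<inter> (\<Inter>y\<in>I. {x \<in> K. f x \<le> f y}) \<noteq> {}"
    proof (cases "I = {}")
      case True
      then show ?thesis using \<open>K \<noteq> {}\<close> by simp
    next
      case False
      then obtain m where "m \<in> I" "\<forall>y\<in>I. f m \<le> f y"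
        using I(1) by (metis arg_min_if_finite(1) arg_min_least)
      then show ?thesis using I(2) by blast
    qed
  qed (use cl in blast)
  then show ?thesis by blast
qed

text \<open>
  At a point where the path exceeds \<open>c\<close>, it exceeds \<open>c\<close> nearby: to the right of the point by
  right-continuity of \<open>\<Lambda>\<close>, to the left because there \<open>\<Lambda>\<close> can only be smaller.  Both are covered
  by the bound \<open>\<Lambda> u \<le> \<Lambda> y\<close> for \<open>u < y\<close>, with \<open>y\<close> slightly to the right of the point.
\<close>

lemma closed_sublevel_drift:
  fixes g \<Lambda> :: "real \<Rightarrow> real"
  assumes g: "continuous_on {0..} g" and mono: "mono_on {0..} \<Lambda>"
    and rc: "\<And>t. 0 \<le> t \<Longrightarrow> continuous (at_right t) \<Lambda>" and "0 \<le> \<alpha>"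
  shows "closed {s \<in> {0..t}. g s - \<alpha> * \<Lambda> s \<le> c}" (is "closed ?K")
proof (subst closed_def, subst open_subopen, intro ballI)
  fix x assume x: "x \<in> - ?K"
  show "\<exists>T. open T \<and> x \<in> T \<and> T \<subseteq> - ?K"
  proof (cases "x \<in> {0..t}")
    case False
    then have "open (- {0..t})" "x \<in> - {0..t}" "- {0..t} \<subseteq> - ?K" by auto
    then show ?thesis by blast
  next
    case True
    then have x0: "0 \<le> x" and gt: "c < g x - \<alpha> * \<Lambda> x" using x by auto
    have "((\<lambda>u. g x - \<alpha> * \<Lambda> u) \<longlongrightarrow> g x - \<alpha> * \<Lambda> x) (at_right x)"
      using rc[OF x0] by (auto simp: continuous_within intro!: tendsto_intros)
    then have "\<forall>\<^sub>F u in at_right x. c < g x - \<alpha> * \<Lambda> u"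
      using gt by (rule order_tendstoD)
    then obtain b where b: "b > x" "\<And>u. x < u \<Longrightarrow> u < b \<Longrightarrow> c < g x - \<alpha> * \<Lambda> u"
      by (auto simp: eventually_at_right_field)
    define y where "y = (x + b) / 2"
    have y: "x < y" "c < g x - \<alpha> * \<Lambda> y" using b by (auto simp: y_def)
    have "\<forall>\<^sub>F u in at x within {0..}. c < g u - \<alpha> * \<Lambda> y"
    proof (rule order_tendstoD(1)[OF _ y(2)])
      show "((\<lambda>u. g u - \<alpha> * \<Lambda> y) \<longlongrightarrow> g x - \<alpha> * \<Lambda> y) (at x within {0..})"
        using g x0 by (auto simp: continuous_on_def intro!: tendsto_intros)
    qed
    then obtain S where S: "open S" "x \<in> S"
        "\<And>u. u \<in> S \<Longrightarrow> u \<noteq> x \<Longrightarrow> 0 \<le> u \<Longrightarrow> c < g u - \<alpha> * \<Lambda> y"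
      unfolding eventually_at_topological by auto
    have "S \<inter> {..<y} \<subseteq> - ?K"
    proof
      fix u assume u: "u \<in> S \<inter> {..<y}"
      show "u \<in> - ?K"
      proof (cases "0 \<le> u")
        case True
        then have "\<Lambda> u \<le> \<Lambda> y" using u by (intro mono_onD[OF mono]) auto
        then have "\<alpha> * \<Lambda> u \<le> \<alpha> * \<Lambda> y" using \<open>0 \<le> \<alpha>\<close> by (rule mult_left_mono)
        moreover have "c < g u - \<alpha> * \<Lambda> y" using S(3)[of u] u True y(2) by (cases "u = x") auto
        ultimately show ?thesis by auto
      qed auto
    qed
    then show ?thesis using S(1,2) y(1) by (intro exI[of _ "S \<inter> {..<y}"]) auto
  qed
qed

section \<open>First passage below zero\<close>

text \<open>
  The passage time is attained.  The compact window extends to \<open>t + 1\<close>, beyond \<open>t\<close>, because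
  an infimum equal to \<open>t\<close> could a priori be approached only by times larger than \<open>t\<close>.
\<close>

lemma passage_time_le_iff:
  fixes f :: "real \<Rightarrow> real"
  assumes cl: "\<And>t c. closed {s \<in> {0..t}. f s \<le> c}"
  shows "Inf {ereal s |s. 0 \<le> s \<and> f s \<le> 0} \<le> ereal t \<longleftrightarrow> (\<exists>s\<in>{0..t}. f s \<le> 0)"
proof
  assume "\<exists>s\<in>{0..t}. f s \<le> 0"
  then obtain s where "0 \<le> s" "s \<le> t" "f s \<le> 0" by auto
  then show "Inf {ereal s |s. 0 \<le> s \<and> f s \<le> 0} \<le> ereal t"
    by (intro Inf_lower2[of "ereal s"]) auto
next
  assume le: "Inf {ereal s |s. 0 \<le> s \<and> f s \<le> 0} \<le> ereal t"
  define K where "K = {s \<in> {0..t + 1}. f s \<le> 0}"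
  have "compact ({0..t + 1} \<inter> K)" unfolding K_def by (intro compact_Int_closed cl) auto
  moreover have "{0..t + 1} \<inter> K = K" by (auto simp: K_def)
  ultimately have cpt: "compact K" by simp
  show "\<exists>s\<in>{0..t}. f s \<le> 0"
  proof (rule ccontr)
    assume none: "\<not> (\<exists>s\<in>{0..t}. f s \<le> 0)"
    obtain m where m: "t < m" "\<And>s. s \<in> K \<Longrightarrow> m \<le> s" "m \<le> t + 1"
    proof (cases "K = {}")
      case True
      then show ?thesis using that[of "t + 1"] by simp
    next
      case False
      then obtain m where "m \<in> K" "\<forall>s\<in>K. m \<le> s"
        using compact_attains_inf[OF cpt] by blast
      then show ?thesis using that[of m] none by (fastforce simp: K_def)
    qed
    have "ereal m \<le> Inf {ereal s |s. 0 \<le> s \<and> f s \<le> 0}"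
    proof (rule Inf_greatest, clarsimp)
      fix s :: real assume "0 \<le> s" "f s \<le> 0"
      then show "m \<le> s" using m(2)[of s] m(3) by (cases "s \<le> t + 1") (auto simp: K_def)
    qed
    then show False using le m(1) by (meson ereal_less_eq(3) leD order_trans)
  qed
qed

text \<open>
  Attainment of the minimum turns the running infimum into an actual visit; this is where the two
  problems meet.
\<close>

lemma running_infimum_le_iff:
  fixes f :: "real \<Rightarrow> real"
  assumes cl: "\<And>c. closed {s \<in> {0..t}. f s \<le> c}" and "0 \<le> t"
  shows "(INF s\<in>{0..t}. f s) \<le> c \<longleftrightarrow> (\<exists>s\<in>{0..t}. f s \<le> c)"
proof -
  obtain x where x: "x \<in> {0..t}" "\<forall>y\<in>{0..t}. f x \<le> f y"
    using compact_attains_inf_of_closed_sublevels[of "{0..t}" f] cl \<open>0 \<le> t\<close> by fastforce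
  have "(INF s\<in>{0..t}. f s) = f x"
    using x by (intro cInf_eq_minimum) auto
  then show ?thesis using x by force
qed

text \<open>
  A positive minimum stays above some \<open>1 / (n + 1)\<close>, and by right-continuity such a bound need
  only be tested at rational times and at \<open>t\<close>.  The endpoint is listed separately because it has no
  times of \<open>[0,t]\<close> to its right.
\<close>

lemma positive_path_iff_rational:
  fixes f :: "real \<Rightarrow> real"
  assumes cl: "\<And>c. closed {s \<in> {0..t}. f s \<le> c}"
    and rc: "\<And>s. 0 \<le> s \<Longrightarrow> continuous (at_right s) f" and "0 \<le> t"
  shows "(\<forall>s\<in>{0..t}. 0 < f s) \<longleftrightarrow> (\<exists>n. \<forall>q\<in>insert t (\<rat> \<inter> {0..t}). 1 / real (Suc n) \<le> f q)"
proof
  assume pos: "\<forall>s\<in>{0..t}. 0 < f s"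
  obtain x where x: "x \<in> {0..t}" "\<forall>y\<in>{0..t}. f x \<le> f y"
    using compact_attains_inf_of_closed_sublevels[of "{0..t}" f] cl \<open>0 \<le> t\<close> by fastforce
  obtain n where "1 / real (Suc n) < f x"
    using pos x(1) nat_approx_posE by blast
  then show "\<exists>n. \<forall>q\<in>insert t (\<rat> \<inter> {0..t}). 1 / real (Suc n) \<le> f q"
    using x(2) \<open>0 \<le> t\<close>
    by (intro exI[of _ n] ballI, elim insertE) (auto intro: order.trans[OF less_imp_le] simp del: of_nat_Suc)
next
  assume "\<exists>n. \<forall>q\<in>insert t (\<rat> \<inter> {0..t}). 1 / real (Suc n) \<le> f q"
  then obtain n where n: "\<And>q. q \<in> insert t (\<rat> \<inter> {0..t}) \<Longrightarrow> 1 / real (Suc n) \<le> f q"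
    by blast
  show "\<forall>s\<in>{0..t}. 0 < f s"
  proof (intro ballI, rule ccontr)
    fix s assume s: "s \<in> {0..t}" and "\<not> 0 < f s"
    then have lt: "f s < 1 / real (Suc n)" by (smt (verit) of_nat_0_less_iff zero_less_Suc zero_less_divide_1_iff)
    then have "s < t" using n[of t] s by (cases "s = t") auto
    have "(f \<longlongrightarrow> f s) (at_right s)" using rc s by (simp add: continuous_within)
    then have "\<forall>\<^sub>F u in at_right s. f u < 1 / real (Suc n)" using lt by (rule order_tendstoD)
    then obtain b where b: "b > s" "\<And>u. s < u \<Longrightarrow> u < b \<Longrightarrow> f u < 1 / real (Suc n)"
      by (auto simp: eventually_at_right_field)
    obtain q where "q \<in> \<rat>" "s < q" "q < min b t"
      using Rats_dense_in_real[of s "min b t"] b(1) \<open>s < t\<close> by auto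
    then show False using b(2)[of q] n[of q] s by auto
  qed
qed

lemma hitting_event_measurable:
  fixes Z :: "real \<Rightarrow> 'a \<Rightarrow> real"
  assumes meas: "\<And>s. 0 \<le> s \<Longrightarrow> Z s \<in> borel_measurable M"
    and cl: "\<And>\<omega> c. \<omega> \<in> space M \<Longrightarrow> closed {s \<in> {0..t}. Z s \<omega> \<le> c}"
    and rc: "\<And>\<omega> s. \<omega> \<in> space M \<Longrightarrow> 0 \<le> s \<Longrightarrow> continuous (at_right s) (\<lambda>s. Z s \<omega>)"
    and "0 \<le> t"
  shows "{\<omega> \<in> space M. \<exists>s\<in>{0..t}. Z s \<omega> \<le> 0} \<in> sets M"
proof -
  define D where "D = insert t (\<rat> \<inter> {0..t})"
  have D: "countable D" "D \<subseteq> {0..}" using \<open>0 \<le> t\<close> by (auto simp: D_def countable_rat)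
  have "{\<omega> \<in> space M. \<exists>s\<in>{0..t}. Z s \<omega> \<le> 0} =
      {\<omega> \<in> space M. \<not> (\<exists>n. \<forall>q\<in>D. 1 / real (Suc n) \<le> Z q \<omega>)}"
  proof (rule Collect_cong, rule conj_cong[OF refl])
    fix \<omega> assume "\<omega> \<in> space M"
    then show "(\<exists>s\<in>{0..t}. Z s \<omega> \<le> 0) \<longleftrightarrow> \<not> (\<exists>n. \<forall>q\<in>D. 1 / real (Suc n) \<le> Z q \<omega>)"
      using positive_path_iff_rational[of t "\<lambda>s. Z s \<omega>"] cl rc \<open>0 \<le> t\<close>
      unfolding D_def by (auto simp: not_less[symmetric] simp del: not_less)
  qed
  also have "\<dots> \<in> sets M"
  proof -
    have "{\<omega> \<in> space M. 1 / real (Suc n) \<le> Z q \<omega>} \<in> sets M" if "q \<in> D" for q n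
      using meas[of q] D(2) that by (intro borel_measurable_le) auto
    then have "{\<omega> \<in> space M. \<forall>q\<in>D. 1 / real (Suc n) \<le> Z q \<omega>} \<in> sets M" for n
      using D(1) by (intro sets.sets_Collect_countable_All')
    then show ?thesis
      by (intro sets.sets_Collect_neg sets.sets_Collect_countable_Ex)
  qed
  finally show ?thesis .
qed

section \<open>The two stopping times\<close>

lemma elastic_L_ge_iff:
  assumes cl: "\<And>c. closed {s \<in> {0..t}. feedback_Y \<alpha> X\<^sub>0 B \<Lambda> s \<omega> \<le> c}"
    and "0 \<le> t" "0 < \<xi> \<omega>"
  shows "\<xi> \<omega> \<le> elastic_L \<alpha> X\<^sub>0 B \<Lambda> t \<omega> \<longleftrightarrow>
    (\<exists>s\<in>{0..t}. feedback_Y \<alpha> (\<lambda>\<omega>. X\<^sub>0 \<omega> + \<xi> \<omega>) B \<Lambda> s \<omega> \<le> 0)"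
proof -
  have "\<xi> \<omega> \<le> elastic_L \<alpha> X\<^sub>0 B \<Lambda> t \<omega> \<longleftrightarrow>
      (INF s\<in>{0..t}. feedback_Y \<alpha> X\<^sub>0 B \<Lambda> s \<omega>) \<le> - \<xi> \<omega>"
    using \<open>0 < \<xi> \<omega>\<close> by (auto simp: elastic_L_def)
  also have "\<dots> \<longleftrightarrow> (\<exists>s\<in>{0..t}. feedback_Y \<alpha> X\<^sub>0 B \<Lambda> s \<omega> \<le> - \<xi> \<omega>)"
    using cl \<open>0 \<le> t\<close> by (rule running_infimum_le_iff)
  also have "\<dots> \<longleftrightarrow> (\<exists>s\<in>{0..t}. feedback_Y \<alpha> (\<lambda>\<omega>. X\<^sub>0 \<omega> + \<xi> \<omega>) B \<Lambda> s \<omega> \<le> 0)"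
    by (rule bex_cong) (auto simp: feedback_Y_def)
  finally show ?thesis .
qed

text \<open>
  The local time has reached \<open>\<xi>\<close> at \<open>t\<close> exactly when the raised path has visited \<open>(-\<infinity>,0]\<close> by
  \<open>t\<close>, so the elastic set of times is the upward closure of the absorbing one, and the infima agree.
\<close>

lemma elastic_tau_eq_absorbing_tau:
  assumes cl: "\<And>t c. closed {s \<in> {0..t}. feedback_Y \<alpha> X\<^sub>0 B \<Lambda> s \<omega> \<le> c}" and "0 < \<xi> \<omega>"
  shows "elastic_tau \<alpha> X\<^sub>0 B \<xi> \<Lambda> \<omega> = absorbing_tau \<alpha> (\<lambda>\<omega>. X\<^sub>0 \<omega> + \<xi> \<omega>) B \<Lambda> \<omega>"
proof -
  note reach = elastic_L_ge_iff[where \<xi> = \<xi>, OF cl _ \<open>0 < \<xi> \<omega>\<close>]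
  show ?thesis
    unfolding elastic_tau_def absorbing_tau_def
  proof (rule antisym; rule Inf_mono)
    fix b assume "b \<in> {ereal t |t. 0 \<le> t \<and> feedback_Y \<alpha> (\<lambda>\<omega>. X\<^sub>0 \<omega> + \<xi> \<omega>) B \<Lambda> t \<omega> \<le> 0}"
    then show "\<exists>a\<in>{ereal t |t. 0 \<le> t \<and> \<xi> \<omega> \<le> elastic_L \<alpha> X\<^sub>0 B \<Lambda> t \<omega>}. a \<le> b"
      using reach by fastforce
  next
    fix b assume "b \<in> {ereal t |t. 0 \<le> t \<and> \<xi> \<omega> \<le> elastic_L \<alpha> X\<^sub>0 B \<Lambda> t \<omega>}"
    then show "\<exists>a\<in>{ereal t |t. 0 \<le> t \<and> feedback_Y \<alpha> (\<lambda>\<omega>. X\<^sub>0 \<omega> + \<xi> \<omega>) B \<Lambda> t \<omega> \<le> 0}. a \<le> b"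
      using reach by fastforce
  qed
qed

lemma elastic_tau_le_of_nonpos:
  assumes "\<xi> \<omega> \<le> 0" "0 \<le> t"
  shows "elastic_tau \<alpha> X\<^sub>0 B \<xi> \<Lambda> \<omega> \<le> ereal t"
  unfolding elastic_tau_def
  using assms by (intro Inf_lower) (auto simp: elastic_L_def)

lemma exponential_AE_pos:
  assumes "distributed M lborel \<xi> (exponential_density \<kappa>)"
  shows "AE \<omega> in M. 0 < \<xi> \<omega>"
proof -
  have "AE x in density lborel (exponential_density \<kappa>). (0::real) < x"
    using AE_lborel_singleton[of "0::real"]
    by (subst AE_density) (auto simp: exponential_density_def split: if_splits elim!: eventually_mono)
  then have "AE x in distr M lborel \<xi>. 0 < x"
    using distributed_distr_eq_density[OF assms] by (simp only:)
  then show ?thesis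
    using distributed_measurable[OF assms] by (subst (asm) AE_distr_iff) auto
qed

theorem lemma2p4:
  fixes M :: "'a measure" and \<alpha> \<kappa> :: real
    and X\<^sub>0 \<xi> :: "'a \<Rightarrow> real" and B :: "real \<Rightarrow> 'a \<Rightarrow> real" and \<Lambda> :: "real \<Rightarrow> real"
  assumes "prob_space M"
    and "\<alpha> > 0" and "\<kappa> > 0"
    and "X\<^sub>0 \<in> borel_measurable M" and "\<forall>\<omega>\<in>space M. X\<^sub>0 \<omega> \<ge> 0"
    and "standard_brownian_motion M B"
    and "distributed M lborel \<xi> (exponential_density \<kappa>)"
    and "indep_var_process_var M X\<^sub>0 B \<xi>"
    and "\<Lambda> \<in> {0..} \<rightarrow> {0..1}" and "mono_on {0..} \<Lambda>" and "cadlag \<Lambda>" and "\<Lambda> 0 = 0"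
  shows "elastic_solution M \<alpha> X\<^sub>0 B \<xi> \<Lambda> \<longleftrightarrow>
         absorbing_solution M \<alpha> (\<lambda>\<omega>. X\<^sub>0 \<omega> + \<xi> \<omega>) B \<Lambda>"
proof -
  define Z where "Z = feedback_Y \<alpha> (\<lambda>\<omega>. X\<^sub>0 \<omega> + \<xi> \<omega>) B \<Lambda>"
  have B_meas: "B s \<in> borel_measurable M" if "0 \<le> s" for s
    using assms(6) that by (auto simp: standard_brownian_motion_def)
  have B_cont: "continuous_on {0..} (\<lambda>s. B s \<omega>)" if "\<omega> \<in> space M" for \<omega>
    using assms(6) that by (auto simp: standard_brownian_motion_def)
  have \<Lambda>_rc: "continuous (at_right s) \<Lambda>" if "0 \<le> s" for s
    using assms(11) that by (auto simp: cadlag_def)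
  have \<xi>_meas: "\<xi> \<in> borel_measurable M"
    using distributed_measurable[OF assms(7)] by simp

  have closed_sublevels: "closed {s \<in> {0..t}. feedback_Y \<alpha> W B \<Lambda> s \<omega> \<le> c}"
    if "\<omega> \<in> space M" for W \<omega> t c
    unfolding feedback_Y_def
    using assms(10) \<Lambda>_rc \<open>\<alpha> > 0\<close>
    by (intro closed_sublevel_drift continuous_on_add continuous_on_const B_cont[OF that]) auto
  have Z_closed: "closed {s \<in> {0..t}. Z s \<omega> \<le> c}" if "\<omega> \<in> space M" for \<omega> t c
    unfolding Z_def using that by (rule closed_sublevels)
  have Z_rc: "continuous (at_right s) (\<lambda>s. Z s \<omega>)" if "\<omega> \<in> space M" "0 \<le> s" for \<omega> s
  proof -
    have "continuous (at s within {0..}) (\<lambda>s. B s \<omega>)"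
      using B_cont[OF that(1)] that(2) by (simp add: continuous_on_eq_continuous_within)
    then have "continuous (at_right s) (\<lambda>s. B s \<omega>)"
      by (rule continuous_within_subset) (use that(2) in auto)
    then show ?thesis
      unfolding Z_def feedback_Y_def using \<Lambda>_rc[OF that(2)] by (intro continuous_intros)
  qed
  have Z_meas: "Z s \<in> borel_measurable M" if "0 \<le> s" for s
    unfolding Z_def feedback_Y_def using assms(4) \<xi>_meas B_meas[OF that] by measurable

  have "measure M {\<omega> \<in> space M. elastic_tau \<alpha> X\<^sub>0 B \<xi> \<Lambda> \<omega> \<le> ereal t} =
      measure M {\<omega> \<in> space M. absorbing_tau \<alpha> (\<lambda>\<omega>. X\<^sub>0 \<omega> + \<xi> \<omega>) B \<Lambda> \<omega> \<le> ereal t}"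
    (is "measure M ?E = measure M ?A") if "0 \<le> t" for t
  proof -
    have "?A = {\<omega> \<in> space M. \<exists>s\<in>{0..t}. Z s \<omega> \<le> 0}"
      unfolding absorbing_tau_def Z_def[symmetric]
      using passage_time_le_iff[OF Z_closed] by blast
    then have A: "?A \<in> sets M"
      using hitting_event_measurable[OF Z_meas Z_closed Z_rc \<open>0 \<le> t\<close>] by simp
    have eq: "elastic_tau \<alpha> X\<^sub>0 B \<xi> \<Lambda> \<omega> = absorbing_tau \<alpha> (\<lambda>\<omega>. X\<^sub>0 \<omega> + \<xi> \<omega>) B \<Lambda> \<omega>"
      if "\<omega> \<in> space M" "0 < \<xi> \<omega>" for \<omega>
      using elastic_tau_eq_absorbing_tau[OF closed_sublevels[OF that(1)], where \<xi> = \<xi>] that(2)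
      by simp
    \<comment> \<open>Where \<open>\<xi> \<le> 0\<close> the elastic time is already \<open>0\<close>; including this null set gives an identity of
      events, hence measurability without completeness of the space.\<close>
    have "?E = {\<omega> \<in> space M. \<xi> \<omega> \<le> 0} \<union> ?A"
      using eq elastic_tau_le_of_nonpos[of \<xi> _ t, OF _ \<open>0 \<le> t\<close>]
      by (simp add: set_eq_iff) (metis not_le)
    moreover have "{\<omega> \<in> space M. \<xi> \<omega> \<le> 0} \<in> sets M"
      using \<xi>_meas by measurable
    ultimately have E: "?E \<in> sets M" using A by simp
    have "AE \<omega> in M. \<omega> \<in> ?E \<longleftrightarrow> \<omega> \<in> ?A"
      using exponential_AE_pos[OF assms(7)] AE_space by eventually_elim (auto simp: eq)
    then show ?thesis using E A by (rule measure_eq_AE)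
  qed
  then show ?thesis by (simp add: elastic_solution_def absorbing_solution_def)
qed

end
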